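(* Single-crew repair scheduling in partially automated distribution networks, as described in the context, is equivalent to the scheduling problem $1\mid outtree\mid \sum w_jC_j$ whose jobs are the islands $J\in\mathcal{J}$, with processing times $p_J=\sum_{j\in J}p_j$, weights $\omega_J=\sum_{j\in J}w_j$, and outtree precedence constraints given by the group soft precedence graph $P$. That is, the two problems have the same optimal value, and if $(J_1,\dots,J_k)$ is an optimal sequence of islands for the problem $1\mid outtree\mid\sum w_jC_j$, then the single-crew schedule that, from time $0$ and without idle time, processes all jobs of $J_1$ consecutively (in any order), then all jobs of $J_2$ consecutively (in any order), and so on up to $J_k$, is optimal for the single-crew repair scheduling problem.
   Context: Problem instance. A finite nonempty set $L$ of jobs (damaged edges of a radial, i.e. tree-shaped, distribution network with one source at the root) is given, with repair times $p_j \ge 0$ and positive weights $w_j$ for $j\in L$. The set $L$ is partitioned into nonempty groups called islands; $\mathcal{J}$ denotes the set of islands. A rooted tree $P$ on $\mathcal{J}$ is given, with edges directed away from the root (the group soft precedence graph). Write $J' \preceq_S J$ if $J'=J$ or $J'$ is an ancestor of $J$ in $P$. The weight of an island is $\omega_J := \sum_{j\in J} w_j$. Single-crew repair scheduling. A feasible single-crew schedule gives each job a start time $S_j\ge 0$, without preemption, the crew working on at most one job at a time. The completion time is $C_j=S_j+p_j$. Jobs may be started in any order: the tree $P$ does not restrict the order of repairs and enters only through energization times. The energization time of island $J$ is $E_J := \max_{J'\preceq_S J}\max_{j\in J'} C_j$. The cost $\sum_{J\in\mathcal{J}}\omega_J E_J$ is to be minimized. The problem $1\mid outtree\mid\sum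 w_jC_j$: on a single machine, without preemption, sequence a set of jobs with given processing times and weights so as to minimize the total weighted completion time, subject to the (hard) precedence constraints of a given rooted tree directed away from its root, i.e. each job may start only after its parent in the tree has completed. *)

theory Defs
  imports Complex_Main "HOL-Library.Disjoint_Sets"
begin

text \<open>
  Two distinct jobs never overlap: one of them completes no later than the other one starts.
  Only the values of \<open>S\<close> on \<open>A\<close> matter, in all feasibility conditions and costs below.
\<close>

definition single_machine :: "'a set \<Rightarrow> ('a \<Rightarrow> real) \<Rightarrow> ('a \<Rightarrow> real) \<Rightarrow> bool" where
  "single_machine A p S \<longleftrightarrow>
     (\<forall>j\<in>A. 0 \<le> S j) \<and>
     (\<forall>i\<in>A. \<forall>j\<in>A. i \<noteq> j \<longrightarrow> S i + p i \<le> S j \<or> S j + p j \<le> S i)"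

text \<open>
  Start times when the jobs of a distinct list are processed in list order, from time \<open>0\<close> and
  without idle time.
\<close>

definition no_idle_schedule :: "('a \<Rightarrow> real) \<Rightarrow> 'a list \<Rightarrow> 'a \<Rightarrow> real" where
  "no_idle_schedule p xs j = (\<Sum>i\<leftarrow>takeWhile (\<lambda>i. i \<noteq> j) xs. p i)"

definition rooted_tree :: "'v set \<Rightarrow> ('v \<times> 'v) set \<Rightarrow> bool" where
  "rooted_tree V E \<longleftrightarrow>
     E \<subseteq> V \<times> V \<and>
     (\<exists>r\<in>V. (\<forall>u. (u, r) \<notin> E) \<and>
            (\<forall>v\<in>V - {r}. \<exists>!u. (u, v) \<in> E) \<and>
            (\<forall>v\<in>V. (r, v) \<in> E\<^sup>*))"

definition min_value :: "('s \<Rightarrow> real) \<Rightarrow> ('s \<Rightarrow> bool) \<Rightarrow> real \<Rightarrow> bool" where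
  "min_value f Q v \<longleftrightarrow> (\<exists>x. is_arg_min f Q x \<and> f x = v)"


subsection \<open>The problem \<open>1 | outtree | \<Sum> w C\<close>\<close>

definition outtree_feasible ::
    "'a set \<Rightarrow> ('a \<Rightarrow> real) \<Rightarrow> ('a \<times> 'a) set \<Rightarrow> ('a \<Rightarrow> real) \<Rightarrow> bool" where
  "outtree_feasible A p E S \<longleftrightarrow>
     single_machine A p S \<and> (\<forall>(i, j)\<in>E. S i + p i \<le> S j)"

definition weighted_completion ::
    "'a set \<Rightarrow> ('a \<Rightarrow> real) \<Rightarrow> ('a \<Rightarrow> real) \<Rightarrow> ('a \<Rightarrow> real) \<Rightarrow> real" where
  "weighted_completion A p w S = (\<Sum>j\<in>A. w j * (S j + p j))"

definition outtree_optimal_sequence ::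
    "'a set \<Rightarrow> ('a \<Rightarrow> real) \<Rightarrow> ('a \<Rightarrow> real) \<Rightarrow> ('a \<times> 'a) set \<Rightarrow> 'a list \<Rightarrow> bool" where
  "outtree_optimal_sequence A p w E xs \<longleftrightarrow>
     distinct xs \<and> set xs = A \<and>
     is_arg_min (weighted_completion A p w) (outtree_feasible A p E) (no_idle_schedule p xs)"


subsection \<open>Single-crew repair scheduling with islands\<close>

text \<open>
  A repair schedule is feasible iff it is feasible for the single crew, i.e. satisfies
  \<^const>\<open>single_machine\<close>; the precedence graph \<open>P\<close> enters only through the energization times.
  Since \<open>(I, J) \<in> P\<^sup>*\<close> is reflexive, an island counts among its own predecessors.
\<close>

definition energization ::
    "'a set set \<Rightarrow> ('a \<Rightarrow> real) \<Rightarrow> ('a set \<times> 'a set) set \<Rightarrow> ('a \<Rightarrow> real) \<Rightarrow> 'a set \<Rightarrow> real" where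
  "energization Js p P S J =
     Max ((\<lambda>I. Max ((\<lambda>j. S j + p j) ` I)) ` {I \<in> Js. (I, J) \<in> P\<^sup>*})"

definition repair_cost ::
    "'a set set \<Rightarrow> ('a \<Rightarrow> real) \<Rightarrow> ('a \<Rightarrow> real) \<Rightarrow> ('a set \<times> 'a set) set \<Rightarrow> ('a \<Rightarrow> real) \<Rightarrow> real" where
  "repair_cost Js p w P S = (\<Sum>J\<in>Js. sum w J * energization Js p P S J)"

end

theory Submission
  imports Defs "HOL-Library.Product_Lexorder"
begin

text \<open>
  Sort the islands by energization time, ties broken by depth in \<open>P\<close>.  By the time an island \<open>J\<close>
  is energized, the crew has finished every island energized no later than \<open>J\<close>, so processing the
  islands without idle time in this order completes \<open>J\<close> no later than it was energized before.
  This turns any repair schedule into an outtree sequence of no larger cost.  Conversely, expanding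
  an outtree sequence into a job sequence energizes each island by its completion time.  The same
  sorting argument, applied to completion times, reduces outtree schedules to the finitely many
  sequences, so that a minimum exists.
\<close>

section \<open>The precedence tree\<close>

text \<open>Induction along the path from the root: a cycle through \<open>z\<close> must enter
  \<open>z\<close> by its only parent \<open>y\<close>, so it also passes through \<open>y\<close>.
  Going back in this way ends at the root, which no edge enters.\<close>

lemma rooted_tree_acyclic:
  assumes "rooted_tree V E"
  shows "acyclic E"
proof -
  obtain r where EV: "E \<subseteq> V \<times> V" and r: "\<forall>u. (u, r) \<notin> E"
    and parent: "\<forall>v\<in>V - {r}. \<exists>!u. (u, v) \<in> E"
    and reach: "\<forall>v\<in>V. (r, v) \<in> E\<^sup>*"
    using assms unfolding rooted_tree_def by (elim conjE bexE)
  have no_cycle: "(v, v) \<notin> E\<^sup>+" if "(r, v) \<in> E\<^sup>*" for v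
    using that
  proof (induction rule: rtrancl_induct)
    case base
    then show ?case using r by (meson tranclE)
  next
    case (step y z)
    show ?case
    proof
      assume "(z, z) \<in> E\<^sup>+"
      then obtain u where u: "(z, u) \<in> E\<^sup>*" "(u, z) \<in> E" by (meson tranclD2)
      have "z \<in> V - {r}" using step.hyps(2) EV r by blast
      then have "u = y" using parent u(2) step.hyps(2) by metis
      then have "(y, y) \<in> E\<^sup>+" using u(1) step.hyps(2) by (simp add: rtrancl_into_trancl2)
      then show False using step.IH by simp
    qed
  qed
  show ?thesis
  proof (rule acyclicI, intro allI notI)
    fix v assume v: "(v, v) \<in> E\<^sup>+"
    then have "v \<in> V" using EV by (meson SigmaD2 subsetD tranclE)
    then show False using v no_cycle reach by blast
  qed
qed

text \<open>The number of ancestors stands in for depth. Ancestor sets grow along an edge, and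
  strictly so, because \<open>v\<close> itself is not an ancestor of \<open>u\<close>. This supplies
  the tie-breaking key for sorting.\<close>

lemma acyclic_ancestor_card_less:
  assumes "finite V" "acyclic E" "(u, v) \<in> E" "v \<in> V"
  shows "card {x \<in> V. (x, u) \<in> E\<^sup>*} < card {x \<in> V. (x, v) \<in> E\<^sup>*}"
proof (rule psubset_card_mono)
  show "finite {x \<in> V. (x, v) \<in> E\<^sup>*}" using assms(1) by simp
  have "(v, u) \<notin> E\<^sup>*"
    using assms(2,3) by (meson acyclic_def rtrancl_into_trancl1)
  moreover have "(x, v) \<in> E\<^sup>*" if "(x, u) \<in> E\<^sup>*" for x
    using that assms(3) by (rule rtrancl_into_rtrancl)
  ultimately show "{x \<in> V. (x, u) \<in> E\<^sup>*} \<subset> {x \<in> V. (x, v) \<in> E\<^sup>*}"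
    using assms(4) by blast
qed

section \<open>Workload of a single machine\<close>

text \<open>Induction in order of start times: all other jobs of the set are finished when the last
  one starts, so the bound for them is its start time, and its own length fits between that time and
  \<open>t\<close>.\<close>

lemma single_machine_sum_le:
  assumes sm: "single_machine A p S" and "finite B" "B \<subseteq> A"
    and p: "\<And>j. j \<in> A \<Longrightarrow> p j \<ge> 0"
    and "\<And>j. j \<in> B \<Longrightarrow> S j + p j \<le> t" and "t \<ge> 0"
  shows "sum p B \<le> t"
proof -
  \<comment> \<open>Jobs of length zero add nothing to the sum, but one may start together with a
    longer job. The latest start would then not guarantee that the others are finished.\<close>
  define B' where "B' = {j \<in> B. p j > 0}"
  have "finite B'" "B' \<subseteq> A" "\<And>j. j \<in> B' \<Longrightarrow> p j > 0" "\<And>j. j \<in> B' \<Longrightarrow> S j + p j \<le> t"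
    using assms by (auto simp: B'_def)
  then have "sum p B' \<le> t" using \<open>t \<ge> 0\<close>
  proof (induction B' arbitrary: t rule: finite_ranking_induct[where f = S])
    case empty
    then show ?case by simp
  next
    case (insert x B')
    show ?case
    proof (cases "x \<in> B'")
      case True
      then show ?thesis using insert.IH[of t] insert.prems by (simp add: insert_absorb)
    next
      case False
      \<comment> \<open>The other alternative, \<open>S x + p x \<le> S y\<close>, contradicts
        \<open>S y \<le> S x\<close> because \<open>p x\<close> is positive.\<close>
      have "S y + p y \<le> S x" if "y \<in> B'" for y
      proof -
        have "S y + p y \<le> S x \<or> S x + p x \<le> S y"
          using sm insert.prems(1) that False by (auto simp: single_machine_def)
        then show ?thesis using insert.hyps(2)[OF that] insert.prems(2)[of x] by auto
      qed
      moreover have "S x \<ge> 0" using sm insert.prems(1) by (auto simp: single_machine_def)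
      \<comment> \<open>The deadline drops from \<open>t\<close> to \<open>S x\<close>, which is why
        \<open>t\<close> is generalized in the induction.\<close>
      ultimately have "sum p B' \<le> S x" using insert.IH[of "S x"] insert.prems by auto
      moreover have "S x + p x \<le> t" using insert.prems by auto
      ultimately show ?thesis using insert.hyps(1) False by simp
    qed
  qed
  moreover have "sum p B = sum p B'"
    using assms(2,3) p by (intro sum.mono_neutral_right) (force simp: B'_def)+
  ultimately show ?thesis by simp
qed

section \<open>Schedules without idle time\<close>

lemma no_idle_schedule_split:
  assumes "j \<notin> set ys"
  shows "no_idle_schedule p (ys @ j # zs) j = sum_list (map p ys)"
proof -
  have "takeWhile (\<lambda>i. i \<noteq> j) (ys @ j # zs) = ys"
    using assms by (subst takeWhile_append2) auto
  then show ?thesis by (simp add: no_idle_schedule_def)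
qed

lemma no_idle_schedule_before:
  assumes "distinct (as @ i # bs @ j # cs)" and "\<And>k. k \<in> set bs \<Longrightarrow> (p k :: real) \<ge> 0"
  shows "no_idle_schedule p (as @ i # bs @ j # cs) i + p i
           \<le> no_idle_schedule p (as @ i # bs @ j # cs) j"
proof -
  have "sum_list (map p bs) \<ge> 0" using assms(2) by (intro sum_list_nonneg) auto
  then show ?thesis
    using assms(1) no_idle_schedule_split[of i as p "bs @ j # cs"]
      no_idle_schedule_split[of j "as @ i # bs" p cs] by auto
qed

lemma distinct_split_two:
  assumes "i \<in> set xs" "j \<in> set xs" "i \<noteq> j"
  obtains as bs cs where "xs = as @ i # bs @ j # cs"
  | as bs cs where "xs = as @ j # bs @ i # cs"
proof -
  obtain as rest where xs: "xs = as @ i # rest" using assms(1) by (meson split_list)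
  show thesis
  proof (cases "j \<in> set rest")
    case True
    then obtain bs cs where "rest = bs @ j # cs" by (meson split_list)
    then show thesis using xs that(1) by simp
  next
    case False
    then have "j \<in> set as" using xs assms by auto
    then obtain bs cs where "as = bs @ j # cs" by (meson split_list)
    then show thesis using xs that(2)[of bs cs rest] by simp
  qed
qed

lemma single_machine_no_idle_schedule:
  assumes "distinct xs" "set xs = A" "\<And>j. j \<in> A \<Longrightarrow> p j \<ge> 0"
  shows "single_machine A p (no_idle_schedule p xs)"
  unfolding single_machine_def
proof (intro conjI ballI impI)
  fix j assume "j \<in> A"
  show "0 \<le> no_idle_schedule p xs j"
    unfolding no_idle_schedule_def using assms
    by (intro sum_list_nonneg) (auto dest: set_takeWhileD)
next
  fix i j assume ij: "i \<in> A" "j \<in> A" "i \<noteq> j"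
  then have "i \<in> set xs" "j \<in> set xs" using assms(2) by auto
  from this \<open>i \<noteq> j\<close>
  show "no_idle_schedule p xs i + p i \<le> no_idle_schedule p xs j \<or>
        no_idle_schedule p xs j + p j \<le> no_idle_schedule p xs i"
  proof (cases rule: distinct_split_two)
    case (1 as bs cs)
    then show ?thesis using no_idle_schedule_before[of as i bs j cs p] assms by auto
  next
    case (2 as bs cs)
    then show ?thesis using no_idle_schedule_before[of as j bs i cs p] assms by auto
  qed
qed

section \<open>Sorting by target times, and existence of optimal sequences\<close>

text \<open>The common sorting argument, with \<open>c\<close> as target completion times. It is
  used with completion times of an outtree schedule, with energization times, and with shifted
  depths.\<close>

lemma ex_no_idle_sequence_completing_by:
  fixes c p :: "'a \<Rightarrow> real"
  assumes "finite A" and E: "E \<subseteq> A \<times> A" "acyclic E"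
    and p: "\<And>j. j \<in> A \<Longrightarrow> p j \<ge> 0"
    and mono: "\<And>i j. (i, j) \<in> E \<Longrightarrow> c i \<le> c j"
    and load: "\<And>j. j \<in> A \<Longrightarrow> sum p {i \<in> A. c i \<le> c j} \<le> c j"
  obtains xs where "distinct xs" "set xs = A" "outtree_feasible A p E (no_idle_schedule p xs)"
    "\<And>j. j \<in> A \<Longrightarrow> no_idle_schedule p xs j + p j \<le> c j"
proof -
  \<comment> \<open>Pairs are compared lexicographically. An edge may leave \<open>c\<close>
    unchanged, but the second component makes the key strictly increase, so sorting respects every
    precedence.\<close>
  define key where "key j = (c j, card {x \<in> A. (x, j) \<in> E\<^sup>*})" for j
  obtain xs0 where xs0: "distinct xs0" "set xs0 = A" using finite_distinct_list[OF \<open>finite A\<close>] by blast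
  define xs where "xs = sort_key key xs0"
  have xs: "distinct xs" "set xs = A" and sorted: "sorted (map key xs)"
    using xs0 by (simp_all add: xs_def)
  show thesis
  proof
    show "distinct xs" "set xs = A" by (fact xs)+
    show "outtree_feasible A p E (no_idle_schedule p xs)"
      unfolding outtree_feasible_def
    proof (intro conjI)
      show "single_machine A p (no_idle_schedule p xs)"
        using xs p by (rule single_machine_no_idle_schedule)
      have "no_idle_schedule p xs i + p i \<le> no_idle_schedule p xs j" if ij: "(i, j) \<in> E" for i j
      proof -
        have mem: "i \<in> set xs" "j \<in> set xs" using ij E xs by auto
        have lt: "key i < key j"
          using mono[OF ij] acyclic_ancestor_card_less[OF \<open>finite A\<close> E(2) ij] mem xs
          by (auto simp: key_def)
        then have "i \<noteq> j" by auto
        from mem this show ?thesis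
        proof (cases rule: distinct_split_two)
          case (1 as bs cs)
          then show ?thesis using no_idle_schedule_before[of as i bs j cs p] xs p by auto
        next
          case (2 as bs cs)
          then have "key j \<le> key i" using sorted by (simp add: sorted_append)
          then show ?thesis using lt by simp
        qed
      qed
      then show "\<forall>(i, j)\<in>E. no_idle_schedule p xs i + p i \<le> no_idle_schedule p xs j" by auto
    qed
  next
    fix j assume j: "j \<in> A"
    then obtain ys zs where split: "xs = ys @ j # zs" using xs by (meson split_list)
    then have ys: "distinct ys" "j \<notin> set ys" "set ys \<subseteq> A" using xs by auto
    have "c i \<le> c j" if "i \<in> set ys" for i
    proof -
      have "key i \<le> key j" using sorted split that by (auto simp: sorted_append)
      then show ?thesis by (auto simp: key_def)
    qed
    \<comment> \<open>The right-hand set may also contain jobs after \<open>j\<close> that tie with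
      it in \<open>c\<close>; the hypothesis \<open>load\<close> already counts them.\<close>
    then have "insert j (set ys) \<subseteq> {i \<in> A. c i \<le> c j}" using j ys by auto
    then have "sum p (insert j (set ys)) \<le> sum p {i \<in> A. c i \<le> c j}"
      using \<open>finite A\<close> p by (intro sum_mono2) auto
    also have "\<dots> \<le> c j" using load j .
    finally show "no_idle_schedule p xs j + p j \<le> c j"
      using ys split no_idle_schedule_split[of j ys p zs] by (simp add: sum_list_distinct_conv_sum_set)
  qed
qed

text \<open>Sorting by the completion times of \<open>S\<close> makes no job finish later than in
  \<open>S\<close>: the jobs completed by any given time have total length at most that
  time.\<close>

lemma ex_no_idle_sequence_dominating:
  assumes "finite A" "E \<subseteq> A \<times> A" "acyclic E"
    and p: "\<And>j. j \<in> A \<Longrightarrow> p j \<ge> 0" and w: "\<And>j. j \<in> A \<Longrightarrow> w j \<ge> 0"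
    and S: "outtree_feasible A p E S"
  obtains xs where "distinct xs" "set xs = A" "outtree_feasible A p E (no_idle_schedule p xs)"
    "weighted_completion A p w (no_idle_schedule p xs) \<le> weighted_completion A p w S"
proof -
  have sm: "single_machine A p S" using S by (simp add: outtree_feasible_def)
  have prec: "S i + p i \<le> S j + p j" if "(i, j) \<in> E" for i j
  proof -
    have "S i + p i \<le> S j" "j \<in> A" using that S assms(2) by (auto simp: outtree_feasible_def)
    then show ?thesis using p[of j] by simp
  qed
  have load: "sum p {i \<in> A. S i + p i \<le> S j + p j} \<le> S j + p j" if "j \<in> A" for j
  proof (rule single_machine_sum_le[OF sm])
    show "0 \<le> S j + p j" using sm p that by (simp add: single_machine_def)
  qed (use assms in auto)
  obtain xs where xs: "distinct xs" "set xs = A" "outtree_feasible A p E (no_idle_schedule p xs)"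
    and le: "\<And>j. j \<in> A \<Longrightarrow> no_idle_schedule p xs j + p j \<le> S j + p j"
    using ex_no_idle_sequence_completing_by[OF assms(1-3) p prec load] by blast
  have "weighted_completion A p w (no_idle_schedule p xs) \<le> weighted_completion A p w S"
    unfolding weighted_completion_def using w le by (intro sum_mono mult_left_mono) auto
  with xs that show thesis by blast
qed

text \<open>Start times range over an infinite set, but every feasible schedule is dominated by one
  of the finitely many feasible sequences, so the best sequence is optimal among all
  schedules.\<close>

lemma ex_outtree_optimal_sequence:
  assumes "finite A" "E \<subseteq> A \<times> A" "acyclic E"
    and p: "\<And>j. j \<in> A \<Longrightarrow> p j \<ge> 0" and w: "\<And>j. j \<in> A \<Longrightarrow> w j \<ge> 0"
  obtains xs where "outtree_optimal_sequence A p w E xs"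
proof -
  define Q where
    "Q = {xs. distinct xs \<and> set xs = A \<and> outtree_feasible A p E (no_idle_schedule p xs)}"
  let ?f = "\<lambda>xs. weighted_completion A p w (no_idle_schedule p xs)"
  have "finite Q"
    by (rule finite_subset[OF _ finite_subset_distinct[OF \<open>finite A\<close>]]) (auto simp: Q_def)
  moreover have "Q \<noteq> {}"
  proof -
    define d where "d j = card {x \<in> A. (x, j) \<in> E\<^sup>*}" for j
    txt \<open>Shifting by \<open>sum p A\<close> makes the depth key satisfy the load condition.\<close>
    have mono: "real (d i) + sum p A \<le> real (d j) + sum p A" if "(i, j) \<in> E" for i j
      using acyclic_ancestor_card_less[OF assms(1,3) that] assms(2) that by (auto simp: d_def)
    have load: "sum p {i \<in> A. real (d i) + sum p A \<le> real (d j) + sum p A} \<le> real (d j) + sum p A" for j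
      using sum_mono2[of A "{i \<in> A. d i \<le> d j}" p] assms(1) p by (simp add: add_increasing)
    show ?thesis
      by (rule ex_no_idle_sequence_completing_by[OF assms(1-3) p mono load]) (auto simp: Q_def)
  qed
  ultimately obtain xs where xs: "is_arg_min ?f (\<lambda>ys. ys \<in> Q) xs"
    using ex_is_arg_min_if_finite by metis
  have "?f xs \<le> weighted_completion A p w S" if S: "outtree_feasible A p E S" for S
  proof -
    obtain ys where "ys \<in> Q" "?f ys \<le> weighted_completion A p w S"
      using ex_no_idle_sequence_dominating[where w = w, OF assms S] by (auto simp: Q_def)
    then show ?thesis using xs by (force simp: is_arg_min_linorder)
  qed
  then have "outtree_optimal_sequence A p w E xs"
    using xs by (auto simp: outtree_optimal_sequence_def is_arg_min_linorder Q_def)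
  with that show thesis .
qed

section \<open>Energization times and outtree completion times\<close>

lemma rtrancl_completion_mono:
  assumes S: "outtree_feasible A p E S" and "E \<subseteq> A \<times> A" and "\<And>j. j \<in> A \<Longrightarrow> p j \<ge> 0"
    and "(i, j) \<in> E\<^sup>*"
  shows "S i + p i \<le> S j + p j"
  using assms(4)
proof (induction rule: rtrancl_induct)
  case (step y z)
  have "S y + p y \<le> S z" "z \<in> A"
    using S assms(2) step.hyps(2) by (auto simp: outtree_feasible_def)
  then show ?case using step.IH assms(3)[of z] by simp
qed simp

text \<open>Replaces the nested maxima by a pointwise bound. Both maxima are over finite nonempty
  sets: islands are nonempty, and \<open>J\<close> precedes itself by reflexivity.\<close>

lemma energization_le_iff:
  assumes "partition_on L Js" "finite L" "J \<in> Js"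
  shows "energization Js p P S J \<le> t \<longleftrightarrow>
    (\<forall>I\<in>Js. (I, J) \<in> P\<^sup>* \<longrightarrow> (\<forall>j\<in>I. S j + p j \<le> t))"
proof -
  have "finite Js" using assms finite_elements by blast
  moreover have "finite I \<and> I \<noteq> {}" if "I \<in> Js" for I
    using that assms by (auto simp: partition_on_def intro: finite_subset[of I L])
  ultimately show ?thesis using assms(3)
    unfolding energization_def by (subst Max_le_iff) auto
qed

lemma sum_partition_on_subset:
  fixes p :: "'a \<Rightarrow> real"
  assumes "partition_on L Js" "finite L" "Ks \<subseteq> Js"
  shows "sum (sum p) Ks = sum p (\<Union>Ks)"
proof -
  have "K \<subseteq> L" if "K \<in> Ks" for K
    using that assms(1,3) by (auto simp: partition_on_def)
  then have "finite K" if "K \<in> Ks" for K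
    using that \<open>finite L\<close> finite_subset by blast
  then show ?thesis
    using partition_onD2[OF assms(1)] assms(3)
    by (subst sum.Union_disjoint) (simp_all add: disjoint_def subset_iff)
qed

text \<open>Lower bound for repair schedules: the sorting argument with energization times as
  targets. These are monotone along \<open>P\<close> because a successor island inherits all
  predecessors.\<close>

lemma ex_outtree_sequence_le_repair_cost:
  assumes "finite L" and p: "\<And>j. j \<in> L \<Longrightarrow> p j \<ge> 0" and w: "\<And>j. j \<in> L \<Longrightarrow> w j \<ge> 0"
    and part: "partition_on L Js" and P: "P \<subseteq> Js \<times> Js" "acyclic P"
    and S: "single_machine L p S"
  obtains xs where "outtree_feasible Js (sum p) P (no_idle_schedule (sum p) xs)"
    "weighted_completion Js (sum p) (sum w) (no_idle_schedule (sum p) xs) \<le> repair_cost Js p w P S"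
proof -
  define c where "c = energization Js p P S"
  have c_le: "c J \<le> t \<longleftrightarrow> (\<forall>I\<in>Js. (I, J) \<in> P\<^sup>* \<longrightarrow> (\<forall>j\<in>I. S j + p j \<le> t))"
    if "J \<in> Js" for J t
    using energization_le_iff[OF part \<open>finite L\<close> that] by (simp add: c_def)
  have completion_le: "S j + p j \<le> c J" if "J \<in> Js" "I \<in> Js" "(I, J) \<in> P\<^sup>*" "j \<in> I" for I J j
    using c_le[OF that(1), of "c J"] that by blast
  have sub: "J \<subseteq> L" if "J \<in> Js" for J using part that by (auto simp: partition_on_def)
  have fin: "finite Js" using part \<open>finite L\<close> finite_elements by blast
  have nonneg: "sum p J \<ge> 0" "sum w J \<ge> 0" if "J \<in> Js" for J
    using sub[OF that] p w by (auto intro!: sum_nonneg)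
  have mono: "c I \<le> c J" if "(I, J) \<in> P" for I J
  proof -
    have "I \<in> Js" "J \<in> Js" using that P by auto
    then show ?thesis
      using that by (auto simp: c_le intro: completion_le rtrancl_into_rtrancl)
  qed
  have load: "sum (sum p) {I \<in> Js. c I \<le> c J} \<le> c J" if J: "J \<in> Js" for J
  proof -
    \<comment> \<open>All jobs of the islands in \<open>?K\<close> are completed by
      \<open>c J\<close>. The islands are disjoint, so their total length is the workload of one set
      of jobs.\<close>
    let ?K = "{I \<in> Js. c I \<le> c J}"
    have "sum (sum p) ?K = sum p (\<Union>?K)"
      by (rule sum_partition_on_subset[OF part \<open>finite L\<close>]) simp
    also have "\<dots> \<le> c J"
    proof (rule single_machine_sum_le[OF S])
      show U: "\<Union>?K \<subseteq> L" using sub by auto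
      then show "finite (\<Union>?K)" using \<open>finite L\<close> finite_subset by blast
      show "S j + p j \<le> c J" if j: "j \<in> \<Union>?K" for j
      proof -
        obtain I where I: "I \<in> Js" "c I \<le> c J" "j \<in> I" using j by auto
        then have "S j + p j \<le> c I" by (intro completion_le) auto
        then show ?thesis using I(2) by simp
      qed
      \<comment> \<open>Islands are nonempty, so \<open>c J\<close> bounds an actual completion time
        and is therefore nonnegative.\<close>
      obtain j where j: "j \<in> J" using J part by (metis partition_onD3 ex_in_conv)
      then have "0 \<le> S j + p j" using S p sub J by (force simp: single_machine_def)
      also have "\<dots> \<le> c J" using completion_le J j by blast
      finally show "0 \<le> c J" .
    qed (use p in auto)
    finally show ?thesis .
  qed
  obtain xs where feas: "outtree_feasible Js (sum p) P (no_idle_schedule (sum p) xs)"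
    and le: "\<And>J. J \<in> Js \<Longrightarrow> no_idle_schedule (sum p) xs J + sum p J \<le> c J"
    using ex_no_idle_sequence_completing_by[OF fin P nonneg(1) mono load] by blast
  have "weighted_completion Js (sum p) (sum w) (no_idle_schedule (sum p) xs) \<le> repair_cost Js p w P S"
    unfolding weighted_completion_def repair_cost_def c_def[symmetric]
    using nonneg le by (intro sum_mono mult_left_mono) auto
  with feas that show thesis by blast
qed

text \<open>The block of \<open>I\<close> starts in the job schedule exactly when \<open>I\<close>
  starts in the island schedule. Within the block, the jobs after \<open>j\<close> have nonnegative
  length.\<close>

lemma no_idle_schedule_concat_completion_le:
  assumes p: "\<And>j. j \<in> set (concat jss) \<Longrightarrow> p j \<ge> (0::real)"
    and dist: "distinct (concat jss)" "distinct (map set jss)"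
    and I: "I \<in> set (map set jss)" "j \<in> I"
  shows "no_idle_schedule p (concat jss) j + p j
           \<le> no_idle_schedule (sum p) (map set jss) I + sum p I"
proof -
  obtain js where js: "js \<in> set jss" "I = set js" using I(1) by auto
  obtain as bs where jss: "jss = as @ js # bs" using js(1) by (meson split_list)
  obtain us vs where us: "js = us @ j # vs" using I(2) js(2) by (meson split_list)
  have cc: "concat jss = (concat as @ us) @ j # vs @ concat bs" using jss us by simp
  then have notin: "j \<notin> set (concat as @ us)" using dist(1) by auto
  have *: "sum_list (map p (concat as)) = sum_list (map (\<lambda>js. sum p (set js)) as)"
    using dist(1) unfolding jss
    by (induction as) (auto simp: sum_list_distinct_conv_sum_set)
  have "no_idle_schedule p (concat jss) j + p j
      = sum_list (map p (concat as)) + (sum_list (map p us) + p j)"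
    unfolding cc by (subst no_idle_schedule_split[OF notin]) simp
  also have "\<dots> \<le> sum_list (map p (concat as)) + sum_list (map p js)"
    using us sum_list_nonneg[of "map p vs"] p cc by auto
  also have "sum_list (map p js) = sum p I"
    using dist(1) jss js by (simp add: sum_list_distinct_conv_sum_set)
  also have "sum_list (map p (concat as)) = no_idle_schedule (sum p) (map set jss) I"
  proof -
    have "I \<notin> set (map set as)" using dist(2) jss js by auto
    from no_idle_schedule_split[OF this, of "sum p" "map set bs"]
    show ?thesis using jss js * by (simp add: comp_def)
  qed
  finally show ?thesis .
qed

text \<open>Upper bound: the precedence constraints make every predecessor of an island complete no
  later than the island itself, so the island is energized by its completion time in the
  sequence.\<close>

lemma repair_cost_concat_le:
  assumes "finite L" and p: "\<And>j. j \<in> L \<Longrightarrow> p j \<ge> 0" and w: "\<And>j. j \<in> L \<Longrightarrow> w j \<ge> 0"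
    and part: "partition_on L Js" and P: "P \<subseteq> Js \<times> Js"
    and feas: "outtree_feasible Js (sum p) P (no_idle_schedule (sum p) (map set jss))"
    and jss: "distinct (map set jss)" "set (map set jss) = Js" "\<And>js. js \<in> set jss \<Longrightarrow> distinct js"
  shows "single_machine L p (no_idle_schedule p (concat jss))"
    and "repair_cost Js p w P (no_idle_schedule p (concat jss))
      \<le> weighted_completion Js (sum p) (sum w) (no_idle_schedule (sum p) (map set jss))"
proof -
  let ?S = "no_idle_schedule p (concat jss)" and ?T = "no_idle_schedule (sum p) (map set jss)"
  \<comment> \<open>Distinctness of \<open>map set jss\<close> excludes two different lists
    enumerating the same island; different islands are disjoint.\<close>
  have dist: "distinct (concat jss)"
  proof (rule distinct_concat)
    show "distinct jss" using jss(1) by (simp add: distinct_map)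
    fix ys zs assume "ys \<in> set jss" "zs \<in> set jss" "ys \<noteq> zs"
    moreover from this have "set ys \<noteq> set zs" using jss(1) by (auto simp: distinct_map inj_on_def)
    ultimately show "set ys \<inter> set zs = {}"
      using part jss(2) by (simp add: partition_on_def disjoint_def image_iff) blast
  qed (use jss in auto)
  have setL: "set (concat jss) = L" using part jss(2) by (auto simp: partition_on_def)
  show "single_machine L p ?S"
    using dist setL p by (rule single_machine_no_idle_schedule)
  have nonneg: "sum p J \<ge> 0" "sum w J \<ge> 0" if "J \<in> Js" for J
    using part that p w by (auto intro!: sum_nonneg simp: partition_on_def)
  have "energization Js p P ?S J \<le> ?T J + sum p J" if J: "J \<in> Js" for J
  proof -
    have "?S j + p j \<le> ?T J + sum p J" if I: "I \<in> Js" "(I, J) \<in> P\<^sup>*" "j \<in> I" for I j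
    proof -
      have "?S j + p j \<le> ?T I + sum p I"
        by (rule no_idle_schedule_concat_completion_le) (use dist jss setL p I in auto)
      also have "\<dots> \<le> ?T J + sum p J"
        using feas P nonneg(1) I(2) by (rule rtrancl_completion_mono)
      finally show ?thesis .
    qed
    then show ?thesis by (simp add: energization_le_iff[OF part \<open>finite L\<close> J])
  qed
  then show "repair_cost Js p w P ?S \<le> weighted_completion Js (sum p) (sum w) ?T"
    unfolding weighted_completion_def repair_cost_def
    using nonneg by (intro sum_mono mult_left_mono) auto
qed

section \<open>Equality of the optimal values and transfer of optimal sequences\<close>

theorem lemma1:
  fixes L :: "'a set" and p w :: "'a \<Rightarrow> real"
    and Js :: "'a set set" and P :: "('a set \<times> 'a set) set"
  assumes "finite L" and "L \<noteq> {}"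
    and "\<And>j. j \<in> L \<Longrightarrow> p j \<ge> 0"
    and "\<And>j. j \<in> L \<Longrightarrow> w j > 0"
    and "partition_on L Js"
    and "rooted_tree Js P"
  shows "(\<exists>v. min_value (repair_cost Js p w P) (single_machine L p) v \<and>
              min_value (weighted_completion Js (sum p) (sum w))
                        (outtree_feasible Js (sum p) P) v) \<and>
         (\<forall>Jseq jss.
            outtree_optimal_sequence Js (sum p) (sum w) P Jseq \<and>
            map set jss = Jseq \<and> (\<forall>js\<in>set jss. distinct js) \<longrightarrow>
            is_arg_min (repair_cost Js p w P) (single_machine L p)
                       (no_idle_schedule p (concat jss)))"
proof -
  let ?rc = "repair_cost Js p w P" and ?wc = "weighted_completion Js (sum p) (sum w)"
  have w: "w j \<ge> 0" if "j \<in> L" for j using assms(4)[OF that] by simp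
  have P: "P \<subseteq> Js \<times> Js" "acyclic P"
    using assms(6) rooted_tree_acyclic by (auto simp: rooted_tree_def)
  \<comment> \<open>The two bounds give \<open>?rc ?S \<le> ?wc ?T \<le> ?rc S'\<close> for every
    repair schedule \<open>S'\<close>. Hence \<open>?S\<close> is optimal, and the choice of
    \<open>?S\<close> for \<open>S'\<close> yields equal values.\<close>
  have transfer: "is_arg_min ?rc (single_machine L p) (no_idle_schedule p (concat jss)) \<and>
      ?rc (no_idle_schedule p (concat jss)) = ?wc (no_idle_schedule (sum p) (map set jss))"
    if opt: "outtree_optimal_sequence Js (sum p) (sum w) P (map set jss)"
      and dist: "\<And>js. js \<in> set jss \<Longrightarrow> distinct js" for jss
  proof -
    let ?S = "no_idle_schedule p (concat jss)" and ?T = "no_idle_schedule (sum p) (map set jss)"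
    have seq: "distinct (map set jss)" "set (map set jss) = Js"
      and feas: "outtree_feasible Js (sum p) P ?T"
      and min: "\<And>T. outtree_feasible Js (sum p) P T \<Longrightarrow> ?wc ?T \<le> ?wc T"
      using opt by (auto simp: outtree_optimal_sequence_def is_arg_min_linorder)
    have S: "single_machine L p ?S" and le: "?rc ?S \<le> ?wc ?T"
      using repair_cost_concat_le[where w = w, OF assms(1,3) w assms(5) P(1) feas seq dist] by simp_all
    have ge: "?wc ?T \<le> ?rc S'" if S': "single_machine L p S'" for S'
    proof -
      obtain xs where "outtree_feasible Js (sum p) P (no_idle_schedule (sum p) xs)"
        and "?wc (no_idle_schedule (sum p) xs) \<le> ?rc S'"
        by (rule ex_outtree_sequence_le_repair_cost[OF assms(1,3) w assms(5) P S'])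
      then show ?thesis using min by fastforce
    qed
    have "?rc ?S = ?wc ?T" using le ge[OF S] by simp
    with S ge show ?thesis by (simp add: is_arg_min_linorder)
  qed
  have sub: "J \<subseteq> L" if "J \<in> Js" for J using assms(5) that by (auto simp: partition_on_def)
  have fin: "finite Js" using assms(1,5) finite_elements by blast
  have nonneg: "sum p J \<ge> 0" "sum w J \<ge> 0" if "J \<in> Js" for J
    using sub[OF that] assms(3) w by (auto intro!: sum_nonneg)
  obtain Jseq where opt: "outtree_optimal_sequence Js (sum p) (sum w) P Jseq"
    using ex_outtree_optimal_sequence[where p = "sum p" and w = "sum w", OF fin P nonneg] by blast
  have "\<exists>js. set js = J \<and> distinct js" if "J \<in> set Jseq" for J
  proof -
    have "J \<subseteq> L" using that opt sub by (simp add: outtree_optimal_sequence_def)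
    then have "finite J" using assms(1) by (rule finite_subset)
    then show ?thesis by (rule finite_distinct_list)
  qed
  \<comment> \<open>Fixing an arbitrary enumeration of each island turns an optimal island sequence
    into a concrete witness that the repair minimum is attained.\<close>
  then obtain f where f: "\<And>J. J \<in> set Jseq \<Longrightarrow> set (f J) = J \<and> distinct (f J)" by metis
  then have jss: "map set (map f Jseq) = Jseq" "\<And>js. js \<in> set (map f Jseq) \<Longrightarrow> distinct js"
    by (auto simp: map_idI)
  show ?thesis
  proof (intro conjI exI allI impI)
    show "min_value ?rc (single_machine L p) (?wc (no_idle_schedule (sum p) Jseq))"
      using transfer[of "map f Jseq", unfolded jss(1), OF opt jss(2)]
      unfolding min_value_def by blast
    show "min_value ?wc (outtree_feasible Js (sum p) P) (?wc (no_idle_schedule (sum p) Jseq))"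
      using opt unfolding min_value_def outtree_optimal_sequence_def by blast
    show "is_arg_min ?rc (single_machine L p) (no_idle_schedule p (concat jss))"
      if "outtree_optimal_sequence Js (sum p) (sum w) P Jseq' \<and>
        map set jss = Jseq' \<and> (\<forall>js\<in>set jss. distinct js)" for Jseq' jss
      using transfer[of jss] that by simp
  qed
qed

end
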